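(* Let $Y=[0,m]$ or $Y=[0,m)$ with $0<m\le\infty$, and let $\circ\colon Y^2\to Y$ be a nondecreasing operator such that $x\circ(y+z)\le(x\circ y)+(x\circ z)$ for all $x,y,z\in Y$ with $y+z\in Y$. Suppose also that there are $q,r>0$ such that $(ax)\circ y\le a^q(x\circ y)^r$ for all $x,y\in Y$ and $a>1$ with $ax\in Y$. Then for any $p>0$, any measurable space $(X,\mathcal{A})$, any subadditive measure $\mu\colon\mathcal{A}\to Y$ and any measurable functions $f,g\colon X\to\mathbb{R}$ such that $|f+g|^p,|f|^p,|g|^p$ take values in $Y$, $$\Big(\int_{\circ,X}|f+g|^p\,d\mu\Big)^{1/(pq+1)}\le\Big(\int_{\circ,X}|f|^p\,d\mu\Big)^{r/(pq+1)}+\Big(\int_{\circ,X}|g|^p\,d\mu\Big)^{r/(pq+1)}.$$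
   Context: A monotone measure on $\mathcal{A}$ is a nondecreasing (with respect to inclusion) set function $\mu\colon\mathcal{A}\to[0,\infty]$ with $\mu(\emptyset)=0$. $\mu\colon\mathcal{A}\to Y$ is subadditive if it is a monotone measure and $\mu(A\cup B)\le\mu(A)+\mu(B)$ for all $A,B\in\mathcal{A}$. An operator $\circ$ is nondecreasing if $a\circ b\le x\circ y$ whenever $a\le x$, $b\le y$. For measurable $f\colon X\to Y$, $\int_{\circ,X}f\,d\mu:=\sup_{t\in Y}\{t\circ\mu(\{f\ge t\})\}$ (possibly $\infty$). *)

theory Defs
  imports "HOL-Analysis.Analysis"
begin

(* Real powers on [0,\<infinity>], meant for exponents r > 0 only, where top powr r = top and 0 powr r = 0. *)
definition epowr :: "ennreal \<Rightarrow> real \<Rightarrow> ennreal" (infixr "epowr" 80) where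
  "x epowr r = (if x = top then top else ennreal (enn2real x powr r))"

(* In contrast to the library's measures, only monotonicity is required, not countable additivity;
   positive states that the empty set has measure 0. *)
definition monotone_measure :: "'a set set \<Rightarrow> ('a set \<Rightarrow> ennreal) \<Rightarrow> bool" where
  "monotone_measure \<A> \<mu> \<longleftrightarrow> positive \<A> \<mu> \<and> increasing \<A> \<mu>"

(* The library's subadditive only speaks about disjoint sets. *)
definition subadditive_measure :: "'a set set \<Rightarrow> ('a set \<Rightarrow> ennreal) \<Rightarrow> bool" where
  "subadditive_measure \<A> \<mu> \<longleftrightarrow>
     monotone_measure \<A> \<mu> \<and> (\<forall>A\<in>\<A>. \<forall>B\<in>\<A>. \<mu> (A \<union> B) \<le> \<mu> A + \<mu> B)"

definition nondecreasing_operator ::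
    "ennreal set \<Rightarrow> (ennreal \<Rightarrow> ennreal \<Rightarrow> ennreal) \<Rightarrow> bool" where
  "nondecreasing_operator Y opr \<longleftrightarrow>
     (\<forall>a\<in>Y. \<forall>b\<in>Y. \<forall>x\<in>Y. \<forall>y\<in>Y. a \<le> x \<longrightarrow> b \<le> y \<longrightarrow> opr a b \<le> opr x y)"

(* M only provides the measurable space; the set function is mu, not emeasure M.
   The supremum is taken in [0,\<infinity>] and need not lie in Y. *)
definition circ_integral ::
    "ennreal set \<Rightarrow> (ennreal \<Rightarrow> ennreal \<Rightarrow> ennreal) \<Rightarrow> 'a measure \<Rightarrow> ('a set \<Rightarrow> ennreal)
      \<Rightarrow> ('a \<Rightarrow> ennreal) \<Rightarrow> ennreal" where
  "circ_integral Y opr M \<mu> f = (SUP t\<in>Y. opr t (\<mu> {x \<in> space M. t \<le> f x}))"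

end

theory Submission
  imports Defs
begin

text \<open>For \<open>\<lambda> + \<kappa> = 1\<close> the level set \<open>{t \<le> |f + g|^p}\<close> is covered by
  \<open>{\<lambda>^p t \<le> |f|^p}\<close> and \<open>{\<kappa>^p t \<le> |g|^p}\<close>, so subadditivity of the measure and of the operator,
  followed by the scaling hypothesis, bound the integral of \<open>|f + g|^p\<close> by
  \<open>\<lambda>^(-pq) F + \<kappa>^(-pq) G\<close>, where \<open>F\<close> and \<open>G\<close> are the \<open>r\<close>-th powers of the integrals of
  \<open>|f|^p\<close> and \<open>|g|^p\<close>. With \<open>s = pq + 1\<close>, the minimum over \<open>\<lambda>\<close> is \<open>(F^(1/s) + G^(1/s))^s\<close>.
  To avoid the degenerate case in which \<open>F\<close> or \<open>G\<close> vanishes, \<open>\<lambda>\<close> and \<open>\<kappa>\<close> are taken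
  proportional to \<open>F^(1/s) + e\<close> and \<open>G^(1/s) + e\<close> with \<open>e > 0\<close>.\<close>

lemma epowr_ennreal: "0 \<le> x \<Longrightarrow> ennreal x epowr r = ennreal (x powr r)"
  by (simp add: epowr_def)

lemma epowr_mono:
  assumes "x \<le> y" and "0 \<le> r"
  shows "x epowr r \<le> y epowr r"
proof (cases "y = top")
  case False
  then have "x < top" "y < top"
    using assms(1) by (auto simp: top.not_eq_extremum intro: order.strict_trans1)
  then show ?thesis
    using assms by (auto simp: epowr_def intro!: ennreal_leI powr_mono2 enn2real_mono)
qed (simp add: epowr_def)

lemma operator_split:
  fixes Y :: "ennreal set"
  assumes down: "\<And>x y. y \<in> Y \<Longrightarrow> x \<le> y \<Longrightarrow> x \<in> Y"
    and mono: "nondecreasing_operator Y opr"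
    and add: "\<And>x y z. x \<in> Y \<Longrightarrow> y \<in> Y \<Longrightarrow> z \<in> Y \<Longrightarrow> y + z \<in> Y \<Longrightarrow> opr x (y + z) \<le> opr x y + opr x z"
    and "t \<in> Y" "a \<in> Y" "b \<in> Y" "c \<in> Y" and le: "c \<le> a + b"
  shows "opr t c \<le> opr t a + opr t b"
proof -
  \<comment> \<open>The sum \<open>a + b\<close> may lie outside \<open>Y\<close>, so \<open>c\<close> is split instead.\<close>
  show ?thesis
  proof (cases "c \<le> a")
    case True
    then have "opr t c \<le> opr t a"
      using assms(2,4,5,7) unfolding nondecreasing_operator_def by blast
    then show ?thesis
      by (rule add_increasing2[rotated]) simp
  next
    case False
    then have c: "c = a + (c - a)"
      by (simp add: add_diff_inverse_ennreal)
    have "c - a \<le> b"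
      using le False by (auto simp: ennreal_minus_le_iff)
    then have Y: "c - a \<in> Y"
      using down \<open>b \<in> Y\<close> by blast
    have "opr t c \<le> opr t a + opr t (c - a)"
      using add[of t a "c - a"] Y \<open>t \<in> Y\<close> \<open>a \<in> Y\<close> \<open>c \<in> Y\<close> c by metis
    also have "opr t (c - a) \<le> opr t b"
      using mono Y \<open>t \<in> Y\<close> \<open>b \<in> Y\<close> \<open>c - a \<le> b\<close>
      unfolding nondecreasing_operator_def by blast
    finally show ?thesis
      by simp
  qed
qed

text \<open>If both alternatives failed, then \<open>\<bar>a\<bar> < l * \<bar>a + b\<bar>\<close>
  and \<open>\<bar>b\<bar> < k * \<bar>a + b\<bar>\<close>; adding these with
  \<open>l + k = 1\<close> would contradict the triangle inequality.\<close>

lemma abs_add_powr_level: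
  fixes a b l k p :: real
  assumes "0 < l" "0 < k" "l + k = 1" "0 < p" and t: "t \<le> ennreal (\<bar>a + b\<bar> powr p)"
  shows "ennreal (l powr p) * t \<le> ennreal (\<bar>a\<bar> powr p) \<or> ennreal (k powr p) * t \<le> ennreal (\<bar>b\<bar> powr p)"
proof -
  \<comment> \<open>Serves both alternatives: \<open>j\<close>, \<open>c\<close> will be
    \<open>l\<close>, \<open>a\<close> or \<open>k\<close>, \<open>b\<close>.\<close>
  have *: "ennreal (j powr p) * t \<le> ennreal (\<bar>c\<bar> powr p)"
    if "0 < j" "j * \<bar>a + b\<bar> \<le> \<bar>c\<bar>" for j c :: real
  proof -
    have "ennreal (j powr p) * t \<le> ennreal (j powr p) * ennreal (\<bar>a + b\<bar> powr p)"
      using t by (rule mult_left_mono) simp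
    also have "\<dots> = ennreal ((j * \<bar>a + b\<bar>) powr p)"
      using that by (simp add: powr_mult flip: ennreal_mult)
    also have "\<dots> \<le> ennreal (\<bar>c\<bar> powr p)"
      using that \<open>0 < p\<close> by (intro ennreal_leI powr_mono2) auto
    finally show ?thesis .
  qed
  have "l * \<bar>a + b\<bar> + k * \<bar>a + b\<bar> = \<bar>a + b\<bar>"
    using \<open>l + k = 1\<close> by (metis distrib_right mult_1)
  then have "l * \<bar>a + b\<bar> \<le> \<bar>a\<bar> \<or> k * \<bar>a + b\<bar> \<le> \<bar>b\<bar>"
    by linarith
  then show ?thesis
    using * assms by blast
qed

text \<open>Write \<open>t\<close> as \<open>l powr - p\<close> times \<open>l powr p * t\<close>.
  The first factor exceeds 1 because \<open>l < 1\<close>, so \<open>scale\<close> applies to it and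
  produces \<open>(l powr - p) powr q\<close>; the second lies below \<open>t\<close>, hence in
  \<open>Y\<close>.\<close>

lemma operator_rescale:
  fixes Y :: "ennreal set" and l p q r :: real
  assumes down: "\<And>x y. y \<in> Y \<Longrightarrow> x \<le> y \<Longrightarrow> x \<in> Y"
    and scale: "\<And>(a::real) x y. a > 1 \<Longrightarrow> x \<in> Y \<Longrightarrow> y \<in> Y \<Longrightarrow> ennreal a * x \<in> Y \<Longrightarrow>
           opr (ennreal a * x) y \<le> ennreal (a powr q) * opr x y epowr r"
    and "0 < l" "l < 1" "0 < p" "t \<in> Y" "c \<in> Y"
  shows "ennreal (l powr p) * t \<in> Y"
    and "opr t c \<le> ennreal (l powr - (p * q)) * opr (ennreal (l powr p) * t) c epowr r"
proof -
  have "l powr p \<le> 1"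
    using assms by (simp add: powr_le1)
  then have "ennreal (l powr p) * t \<le> 1 * t"
    by (intro mult_right_mono) (simp_all flip: ennreal_1)
  then show Y: "ennreal (l powr p) * t \<in> Y"
    using down \<open>t \<in> Y\<close> by simp
  have t: "ennreal (l powr - p) * (ennreal (l powr p) * t) = t"
    using \<open>0 < l\<close> by (simp add: mult.assoc[symmetric] powr_minus flip: ennreal_mult)
  have "1 < l powr - p"
    using assms powr_less_mono2_neg[of "- p" l 1] by simp
  from scale[OF this Y \<open>c \<in> Y\<close>]
  show "opr t c \<le> ennreal (l powr - (p * q)) * opr (ennreal (l powr p) * t) c epowr r"
    using t \<open>t \<in> Y\<close> by (simp add: powr_powr)
qed

theorem theorem2:
  fixes m :: ennreal and Y :: "ennreal set"
    and opr :: "ennreal \<Rightarrow> ennreal \<Rightarrow> ennreal"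
    and q r p :: real
    and M :: "'a measure" and \<mu> :: "'a set \<Rightarrow> ennreal"
    and f g :: "'a \<Rightarrow> real"
  assumes "0 < m" and "Y = {0..m} \<or> Y = {0..<m}"
    and "\<And>x y. x \<in> Y \<Longrightarrow> y \<in> Y \<Longrightarrow> opr x y \<in> Y"
    and "nondecreasing_operator Y opr"
    and "\<And>x y z. x \<in> Y \<Longrightarrow> y \<in> Y \<Longrightarrow> z \<in> Y \<Longrightarrow> y + z \<in> Y \<Longrightarrow> opr x (y + z) \<le> opr x y + opr x z"
    and "q > 0" and "r > 0"
    and "\<And>(a::real) x y. a > 1 \<Longrightarrow> x \<in> Y \<Longrightarrow> y \<in> Y \<Longrightarrow> ennreal a * x \<in> Y \<Longrightarrow>
           opr (ennreal a * x) y \<le> ennreal (a powr q) * opr x y epowr r"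
    and "p > 0"
    and "subadditive_measure (sets M) \<mu>"
    and "\<And>A. A \<in> sets M \<Longrightarrow> \<mu> A \<in> Y"
    and "f \<in> borel_measurable M" and "g \<in> borel_measurable M"
    and "\<And>x. x \<in> space M \<Longrightarrow> ennreal (\<bar>f x + g x\<bar> powr p) \<in> Y"
    and "\<And>x. x \<in> space M \<Longrightarrow> ennreal (\<bar>f x\<bar> powr p) \<in> Y"
    and "\<And>x. x \<in> space M \<Longrightarrow> ennreal (\<bar>g x\<bar> powr p) \<in> Y"
  shows "circ_integral Y opr M \<mu> (\<lambda>x. ennreal (\<bar>f x + g x\<bar> powr p)) epowr (1 / (p * q + 1))
    \<le> circ_integral Y opr M \<mu> (\<lambda>x. ennreal (\<bar>f x\<bar> powr p)) epowr (r / (p * q + 1))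
      + circ_integral Y opr M \<mu> (\<lambda>x. ennreal (\<bar>g x\<bar> powr p)) epowr (r / (p * q + 1))"
proof -
  define s where "s = p * q + 1"
  have s: "1 < s" "p * q = s - 1"
    using \<open>q > 0\<close> \<open>p > 0\<close> by (simp_all add: s_def)
  have down: "x \<in> Y" if "y \<in> Y" "x \<le> y" for x y
    using assms(2) that by auto
  let ?L = "\<lambda>h t. {x \<in> space M. t \<le> ennreal (\<bar>h x\<bar> powr p)}"
  let ?I = "\<lambda>h. circ_integral Y opr M \<mu> (\<lambda>x. ennreal (\<bar>h x\<bar> powr p))"
  have meas: "?L h t \<in> sets M" if "h \<in> borel_measurable M" for h t
    using that by measurable
  have fg: "(\<lambda>x. f x + g x) \<in> borel_measurable M"
    using assms(12,13) by measurable
  have \<mu>_mono: "\<mu> A \<le> \<mu> B" if "A \<subseteq> B" "A \<in> sets M" "B \<in> sets M" for A B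
    using assms(10) that unfolding subadditive_measure_def monotone_measure_def increasing_def by blast
  have \<mu>_Un: "\<mu> (A \<union> B) \<le> \<mu> A + \<mu> B" if "A \<in> sets M" "B \<in> sets M" for A B
    using assms(10) that unfolding subadditive_measure_def by blast
  have part: "opr t (\<mu> (?L h (ennreal (l powr p) * t))) \<le> ennreal (l powr - (p * q)) * ?I h epowr r"
    if "h \<in> borel_measurable M" "0 < l" "l < 1" "t \<in> Y" for h l t
  proof -
    let ?t = "ennreal (l powr p) * t"
    have c: "\<mu> (?L h ?t) \<in> Y"
      using meas[OF that(1)] assms(11) by blast
    have rescale: "?t \<in> Y"
        "opr t (\<mu> (?L h ?t)) \<le> ennreal (l powr - (p * q)) * opr ?t (\<mu> (?L h ?t)) epowr r"
      by (rule operator_rescale[where Y = Y]; fact down assms(8) that \<open>p > 0\<close> c)+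
    \<comment> \<open>The rescaled level \<open>?t\<close> is again in \<open>Y\<close>, and the set
      is exactly its level set, so this value is one of those in the supremum.\<close>
    have "opr ?t (\<mu> (?L h ?t)) \<le> ?I h"
      unfolding circ_integral_def using rescale(1) by (rule SUP_upper)
    then have "opr ?t (\<mu> (?L h ?t)) epowr r \<le> ?I h epowr r"
      using \<open>r > 0\<close> by (intro epowr_mono) auto
    then show ?thesis
      using rescale(2) by (meson mult_left_mono order_trans zero_le)
  qed
  \<comment> \<open>For fixed weights the bound is free of \<open>t\<close>, so it passes to the
    supremum; only the integral on the left is unfolded.\<close>
  have bound: "?I (\<lambda>x. f x + g x) \<le>
      ennreal (l powr - (p * q)) * ?I f epowr r + ennreal (k powr - (p * q)) * ?I g epowr r"
    if lk: "0 < l" "0 < k" "l + k = 1" for l k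
    unfolding circ_integral_def[of Y opr M \<mu> "\<lambda>x. ennreal (\<bar>f x + g x\<bar> powr p)"]
  proof (rule SUP_least)
    fix t assume t: "t \<in> Y"
    let ?A = "?L f (ennreal (l powr p) * t)" and ?B = "?L g (ennreal (k powr p) * t)"
    let ?C = "?L (\<lambda>x. f x + g x) t"
    have sets: "?A \<in> sets M" "?B \<in> sets M" "?C \<in> sets M"
      using meas assms(12,13) fg by blast+
    have "?C \<subseteq> ?A \<union> ?B"
      using abs_add_powr_level[OF lk \<open>p > 0\<close>] by blast
    then have "\<mu> ?C \<le> \<mu> ?A + \<mu> ?B"
      using \<mu>_mono \<mu>_Un sets by (meson order_trans sets.Un)
    have "\<mu> ?A \<in> Y" "\<mu> ?B \<in> Y" "\<mu> ?C \<in> Y"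
      using assms(11) sets by blast+
    note le = this \<open>\<mu> ?C \<le> \<mu> ?A + \<mu> ?B\<close>
    have "opr t (\<mu> ?C) \<le> opr t (\<mu> ?A) + opr t (\<mu> ?B)"
      by (rule operator_split[where Y = Y]; fact down assms(4,5) t le)
    also have "\<dots> \<le> ennreal (l powr - (p * q)) * ?I f epowr r + ennreal (k powr - (p * q)) * ?I g epowr r"
      using part assms(12,13) lk t by (intro add_mono) auto
    finally show "opr t (\<mu> ?C) \<le> \<dots>" .
  qed
  show ?thesis
  \<comment> \<open>An infinite integral makes the right-hand side \<open>top\<close>. Otherwise
    both are finite and the optimization takes place in the reals.\<close>
  proof (cases "?I f = top \<or> ?I g = top")
    case True
    then show ?thesis
      by (auto simp: epowr_def)
  next
    case False
    define i j where "i = enn2real (?I f)" and "j = enn2real (?I g)"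
    \<comment> \<open>These are the two summands on the right of the claim; the bound involves their
      \<open>s\<close>-th powers.\<close>
    define u v where "u = i powr (r / s)" and "v = j powr (r / s)"
    have ij: "?I f = ennreal i" "?I g = ennreal j" "0 \<le> i" "0 \<le> j"
      using False by (simp_all add: i_def j_def top.not_eq_extremum)
    have uv: "i powr r = u powr s" "j powr r = v powr s" "0 \<le> u" "0 \<le> v"
      using s by (simp_all add: u_def v_def powr_powr)
    \<comment> \<open>Applied with \<open>W = U + V\<close>, once for each summand: since
      \<open>s - p * q = 1\<close>, a single factor \<open>U\<close> survives, and the two estimates
      add up to \<open>W * W powr (p * q) = W powr s\<close>.\<close>
    have term_le: "(U / W) powr - (p * q) * w powr s \<le> U * W powr (p * q)"
      if "0 \<le> w" "w \<le> U" "0 < U" "0 < W" for U W w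
    proof -
      have "(U / W) powr - (p * q) * w powr s \<le> (U / W) powr - (p * q) * U powr s"
        using that s by (intro mult_left_mono powr_mono2) auto
      also have "\<dots> = U powr s / U powr (p * q) * W powr (p * q)"
        using that by (simp add: powr_minus powr_divide field_simps)
      also have "U powr s / U powr (p * q) = U"
        using that s by (simp flip: powr_diff)
      finally show ?thesis .
    qed
    have "?I (\<lambda>x. f x + g x) epowr (1 / s) \<le> ennreal u + ennreal v + ennreal e" if "0 < e" for e
    proof -
      \<comment> \<open>The halves make \<open>U + V\<close> exceed \<open>u + v\<close> by exactly
        \<open>e\<close>, while both weights stay positive even if \<open>u\<close> or
        \<open>v\<close> is 0.\<close>
      define U V where "U = u + e / 2" and "V = v + e / 2"
      have UV: "0 < U" "0 < V" "u \<le> U" "v \<le> V" "0 < U + V"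
        using uv \<open>0 < e\<close> by (simp_all add: U_def V_def)
      let ?l = "U / (U + V)" and ?k = "V / (U + V)"
      have "?I (\<lambda>x. f x + g x) \<le>
          ennreal (?l powr - (p * q)) * ?I f epowr r + ennreal (?k powr - (p * q)) * ?I g epowr r"
        using UV by (intro bound) (simp_all flip: add_divide_distrib)
      also have "\<dots> = ennreal (?l powr - (p * q) * u powr s + ?k powr - (p * q) * v powr s)"
        by (simp add: ij uv epowr_ennreal ennreal_mult)
      also have "\<dots> \<le> ennreal (U * (U + V) powr (p * q) + V * (U + V) powr (p * q))"
        using UV uv by (intro ennreal_leI add_mono term_le) auto
      also have "U * (U + V) powr (p * q) + V * (U + V) powr (p * q) = (U + V) powr s"
        using UV by (simp add: s_def powr_add algebra_simps)
      finally have "?I (\<lambda>x. f x + g x) epowr (1 / s) \<le> ennreal ((U + V) powr s) epowr (1 / s)"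
        using s by (intro epowr_mono) auto
      also have "\<dots> = ennreal (U + V)"
        using UV s by (simp add: epowr_ennreal powr_powr)
      also have "U + V = u + v + e"
        by (simp add: U_def V_def)
      finally show ?thesis
        using uv \<open>0 < e\<close> by simp
    qed
    then have "?I (\<lambda>x. f x + g x) epowr (1 / s) \<le> ennreal u + ennreal v"
      by (rule ennreal_le_epsilon)
    then show ?thesis
      by (simp add: ij epowr_ennreal u_def v_def s_def)
  qed
qed

end
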